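(* Let $G=M\circ_Z N$ be a group, and let $Z=X_0\times Y_0$ be a set-direct decomposition of $Z$. Assume that $[M,M]\cap Z\subseteq K_Z(X_0)$ and $[N,N]\cap Z\subseteq K_Z(Y_0)$. Then $G$ has a set-direct factorization $G=X\times Y$ with $X\subseteq M$, $Y\subseteq N$, $X\cap Z=X_0$ and $Y\cap Z=Y_0$.
   Context: Groups may be infinite. A subset of a group $G$ is normal if it is invariant under conjugation by all elements of $G$. Set-direct product: for a group $G$ and non-empty subsets $X,Y\subseteq G$, the setwise product $XY$ is called direct, and is then written $X\times Y$, if both $X$ and $Y$ are normal in $G$ and every $g\in XY$ has a unique representation $g=xy$ with $x\in X$, $y\in Y$. A set-direct factorization (decomposition) of $G$ is an equality $G=X\times Y$. Central product: $G=M\circ_Z N$ means that $M,N$ are subgroups of $G$ with $G=MN$, $M$ and $N$ centralize each other, and $Z=M\cap N$ (then $M,N$ are normal and $Z$ is central in $G$). Non-standard commutator notation: for subsets $A,B$ of a group, $[A,B]$ denotes the set (not the generated subgroup) of all commutators $[a,b]=a^{-1}b^{-1}ab$ with $a\in A$, $b\in B$. Kernel: for an abelian group $H$ and $S\subseteq H$, $K_H(S):=\{h\in H: hS=S\}$. *)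

theory Defs
  imports "HOL-Algebra.Coset"
begin

text \<open>A subgroup \<open>H\<close> of \<open>G\<close> is regarded as a group in its own right as \<open>G\<lparr>carrier := H\<rparr>\<close>, so the
  notions below, which are all relative to a group, also apply to \<open>H\<close>.\<close>

definition normal_subset :: "('a, 'b) monoid_scheme \<Rightarrow> 'a set \<Rightarrow> bool" where
  "normal_subset G S \<longleftrightarrow>
     S \<subseteq> carrier G \<and>
     (\<forall>g \<in> carrier G. (\<lambda>s. inv\<^bsub>G\<^esub> g \<otimes>\<^bsub>G\<^esub> s \<otimes>\<^bsub>G\<^esub> g) ` S = S)"

definition set_direct :: "('a, 'b) monoid_scheme \<Rightarrow> 'a set \<Rightarrow> 'a set \<Rightarrow> bool" where
  "set_direct G X Y \<longleftrightarrow>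
     X \<noteq> {} \<and> Y \<noteq> {} \<and> normal_subset G X \<and> normal_subset G Y \<and>
     (\<forall>g \<in> X <#>\<^bsub>G\<^esub> Y. \<exists>!p. p \<in> X \<times> Y \<and> g = fst p \<otimes>\<^bsub>G\<^esub> snd p)"

definition set_direct_factorization ::
    "('a, 'b) monoid_scheme \<Rightarrow> 'a set \<Rightarrow> 'a set \<Rightarrow> bool" where
  "set_direct_factorization G X Y \<longleftrightarrow> set_direct G X Y \<and> carrier G = X <#>\<^bsub>G\<^esub> Y"

definition central_product ::
    "('a, 'b) monoid_scheme \<Rightarrow> 'a set \<Rightarrow> 'a set \<Rightarrow> 'a set \<Rightarrow> bool" where
  "central_product G M N Z \<longleftrightarrow>
     subgroup M G \<and> subgroup N G \<and> carrier G = M <#>\<^bsub>G\<^esub> N \<and>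
     (\<forall>m \<in> M. \<forall>n \<in> N. m \<otimes>\<^bsub>G\<^esub> n = n \<otimes>\<^bsub>G\<^esub> m) \<and>
     Z = M \<inter> N"

text \<open>The set of commutators, not the subgroup generated by it; \<open>[a, b] = a\<^sup>-\<^sup>1b\<^sup>-\<^sup>1ab\<close>, as opposed to the
  convention \<open>aba\<^sup>-\<^sup>1b\<^sup>-\<^sup>1\<close> of \<open>derived_set\<close> in \<open>HOL-Algebra\<close>.\<close>

definition commutator_set :: "('a, 'b) monoid_scheme \<Rightarrow> 'a set \<Rightarrow> 'a set \<Rightarrow> 'a set" where
  "commutator_set G A B =
     {inv\<^bsub>G\<^esub> a \<otimes>\<^bsub>G\<^esub> inv\<^bsub>G\<^esub> b \<otimes>\<^bsub>G\<^esub> a \<otimes>\<^bsub>G\<^esub> b | a b. a \<in> A \<and> b \<in> B}"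

definition set_kernel :: "('a, 'b) monoid_scheme \<Rightarrow> 'a set \<Rightarrow> 'a set" where
  "set_kernel H S = {h \<in> carrier H. h <#\<^bsub>H\<^esub> S = S}"

end

theory Submission
  imports Defs
begin

text \<open>Conjugation by \<open>G\<close> permutes the cosets of \<open>Z\<close> in \<open>M\<close>. Pick one representative \<open>r\<close> in one coset of
  each orbit, with \<open>r = 1\<close> for the orbit of \<open>Z\<close>, and let \<open>X\<close> be the union of all the sets \<open>r\<^sup>g X\<^sub>0\<close>. If
  \<open>r\<^sup>g\<close> and \<open>r\<^sup>h\<close> lie in the same coset of \<open>Z\<close>, they differ by an element of \<open>[M, M] \<inter> Z\<close>, which
  stabilises \<open>X\<^sub>0\<close>; hence \<open>X\<close> meets every coset of \<open>Z\<close> in \<open>M\<close> in a single translate of \<open>X\<^sub>0\<close>.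
  With \<open>Y\<close> constructed from \<open>Y\<^sub>0\<close> in the same way, the cosets \<open>mZ\<close> and \<open>nZ\<close> contribute
  \<open>a X\<^sub>0 b Y\<^sub>0 = abZ = mnZ\<close> to \<open>XY\<close>, and
  uniqueness in \<open>XY\<close> reduces to uniqueness in \<open>X\<^sub>0Y\<^sub>0\<close>.\<close>

context group
begin

section \<open>Conjugation and normal subsets\<close>

definition conjugate :: "'a \<Rightarrow> 'a \<Rightarrow> 'a" where
  "conjugate g x = inv g \<otimes> x \<otimes> g"

lemma conjugate_closed [simp]:
  "g \<in> carrier G \<Longrightarrow> x \<in> carrier G \<Longrightarrow> conjugate g x \<in> carrier G"
  by (simp add: conjugate_def)

lemma conjugate_one_left [simp]: "x \<in> carrier G \<Longrightarrow> conjugate \<one> x = x"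
  by (simp add: conjugate_def)

lemma conjugate_one_right [simp]: "g \<in> carrier G \<Longrightarrow> conjugate g \<one> = \<one>"
  by (simp add: conjugate_def)

lemma conjugate_conjugate:
  assumes "g \<in> carrier G" "h \<in> carrier G" "x \<in> carrier G"
  shows "conjugate h (conjugate g x) = conjugate (g \<otimes> h) x"
  using assms by (simp add: conjugate_def inv_mult_group m_assoc)

lemma conjugate_inv_cancel [simp]:
  assumes "g \<in> carrier G" "x \<in> carrier G"
  shows "conjugate (inv g) (conjugate g x) = x" "conjugate g (conjugate (inv g) x) = x"
  using assms by (simp_all add: conjugate_conjugate)

lemma conjugate_mult:
  assumes "g \<in> carrier G" "x \<in> carrier G" "y \<in> carrier G"
  shows "conjugate g (x \<otimes> y) = conjugate g x \<otimes> conjugate g y"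
proof -
  have "g \<otimes> (inv g \<otimes> (y \<otimes> g)) = y \<otimes> g"
    using assms by (simp add: m_assoc [symmetric])
  then show ?thesis
    using assms by (simp add: conjugate_def m_assoc)
qed

lemma conjugate_commute:
  assumes "g \<in> carrier G" "x \<in> carrier G" "g \<otimes> x = x \<otimes> g"
  shows "conjugate g x = x"
proof -
  have "conjugate g x = inv g \<otimes> (g \<otimes> x)"
    using assms(1,2) by (simp add: conjugate_def m_assoc assms(3))
  also have "\<dots> = x"
    using assms(1,2) by (simp add: m_assoc [symmetric])
  finally show ?thesis .
qed

text \<open>Closure under conjugation suffices: applied to \<open>inv g\<close> it yields the
  reverse inclusion.\<close>

lemma normal_subsetI:
  assumes "S \<subseteq> carrier G"
    and "\<And>g s. g \<in> carrier G \<Longrightarrow> s \<in> S \<Longrightarrow> conjugate g s \<in> S"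
  shows "normal_subset G S"
  unfolding normal_subset_def conjugate_def [symmetric]
proof (intro conjI ballI assms(1) equalityI subsetI)
  fix g x assume g: "g \<in> carrier G"
  show "x \<in> S" if "x \<in> conjugate g ` S"
    using that assms(2) [OF g] by auto
  show "x \<in> conjugate g ` S" if x: "x \<in> S"
  proof
    show "x = conjugate g (conjugate (inv g) x)"
      using g x assms(1) by auto
    show "conjugate (inv g) x \<in> S"
      using g x assms(2) by simp
  qed
qed

text \<open>With \<open>a\<close>, \<open>b\<close> coset representatives and \<open>u\<close>,
  \<open>v\<close> in \<open>Z\<close>, this collects the central parts and so reduces equations in
  \<open>G\<close> to equations in \<open>Z\<close>.\<close>

lemma central_factor_swap:
  assumes "a \<in> carrier G" "u \<in> carrier G" "b \<in> carrier G" "v \<in> carrier G"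
    and "u \<otimes> b = b \<otimes> u"
  shows "a \<otimes> u \<otimes> (b \<otimes> v) = a \<otimes> b \<otimes> (u \<otimes> v)"
proof -
  have "a \<otimes> u \<otimes> (b \<otimes> v) = a \<otimes> (u \<otimes> b) \<otimes> v"
    using assms(1-4) by (simp add: m_assoc)
  then show ?thesis
    using assms by (simp add: m_assoc)
qed

section \<open>Extending a subset of a central subgroup to a normal subset\<close>

text \<open>The construction for one factor. The element
  \<open>inv m \<otimes> conjugate g m\<close> is the commutator \<open>[m, g]\<close>; here
  \<open>g\<close> ranges over all of \<open>G\<close> because \<open>X\<close> must be normal in
  \<open>G\<close>. The last conclusion is what both existence and uniqueness of factorizations in
  \<open>G\<close> rest on.\<close>

lemma normal_extension_of_central_subset:
  assumes M: "subgroup M G" and Z: "subgroup Z G" and ZM: "Z \<subseteq> M"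
    and conjM: "\<And>g m. g \<in> carrier G \<Longrightarrow> m \<in> M \<Longrightarrow> conjugate g m \<in> M"
    and central: "\<And>g z. g \<in> carrier G \<Longrightarrow> z \<in> Z \<Longrightarrow> g \<otimes> z = z \<otimes> g"
    and SZ: "S \<subseteq> Z"
    and stab: "\<And>g m. g \<in> carrier G \<Longrightarrow> m \<in> M \<Longrightarrow> inv m \<otimes> conjugate g m \<in> Z
                 \<Longrightarrow> (inv m \<otimes> conjugate g m) <# S = S"
  obtains X where "X \<subseteq> M" "normal_subset G X" "X \<inter> Z = S"
    "\<And>m. m \<in> M \<Longrightarrow> \<exists>a \<in> m <# Z. X \<inter> (m <# Z) = a <# S"
proof -
  note Mcl [simp] = subgroup.mem_carrier [OF M] and Zcl [simp] = subgroup.mem_carrier [OF Z]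
  have Scl [simp]: "s \<in> carrier G" if "s \<in> S" for s using that SZ by auto
  have conjZ: "conjugate g z = z" if "g \<in> carrier G" "z \<in> Z" for g z
    using that by (intro conjugate_commute central) auto
  have conj_multZ: "conjugate g (x \<otimes> z) = conjugate g x \<otimes> z"
    if "g \<in> carrier G" "x \<in> carrier G" "z \<in> Z" for g x z
    using that by (simp add: conjugate_mult conjZ)
  \<comment> \<open>For \<open>m\<close> in \<open>M\<close>, \<open>C m\<close> is the union of the
    cosets in the orbit of \<open>m <# Z\<close>. The facts below show that these sets partition
    \<open>M\<close>, which replaces an action on a quotient.\<close>
  define C where "C m = {conjugate g m \<otimes> z | g z. g \<in> carrier G \<and> z \<in> Z}" for m
  have C_trans: "C m' \<subseteq> C m" if m: "m \<in> M" and m': "m' \<in> C m" for m m'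
  proof
    fix x assume "x \<in> C m'"
    then obtain h w where h: "h \<in> carrier G" "w \<in> Z" "x = conjugate h m' \<otimes> w"
      unfolding C_def by auto
    obtain g z where g: "g \<in> carrier G" "z \<in> Z" "m' = conjugate g m \<otimes> z"
      using m' unfolding C_def by auto
    have "x = conjugate (g \<otimes> h) m \<otimes> (z \<otimes> w)"
      using g h m by (simp add: conj_multZ conjugate_conjugate m_assoc)
    moreover have "z \<otimes> w \<in> Z" using g h subgroup.m_closed [OF Z] by simp
    ultimately show "x \<in> C m" unfolding C_def using g h by blast
  qed
  have C_sym: "m \<in> C m'" if m: "m \<in> M" and m': "m' \<in> C m" for m m'
  proof -
    obtain g z where g: "g \<in> carrier G" "z \<in> Z" "m' = conjugate g m \<otimes> z"
      using m' unfolding C_def by auto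
    have "m = conjugate (inv g) m' \<otimes> inv z"
      using g m by (simp add: conj_multZ m_assoc)
    moreover have "inv z \<in> Z" using g subgroup.m_inv_closed [OF Z] by simp
    ultimately show ?thesis unfolding C_def using g by blast
  qed
  have CM: "C m \<subseteq> M" if "m \<in> M" for m
    using that ZM conjM subgroup.m_closed [OF M] by (auto simp: C_def)
  have C_eq: "C m' = C m" if "m \<in> M" "m' \<in> C m" for m m'
    using that C_trans C_sym CM by (meson subset_antisym subsetD)
  have C_coset: "m \<otimes> z \<in> C m" if "m \<in> M" "z \<in> Z" for m z
    using that unfolding C_def by (intro CollectI exI [of _ \<one>] exI [of _ z]) simp
  have C_conj: "conjugate g m \<in> C m" if "m \<in> M" "g \<in> carrier G" for m g
    using that subgroup.one_closed [OF Z] unfolding C_def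
    by (intro CollectI exI [of _ g] exI [of _ \<one>]) simp
  have C_self: "m \<in> C m" if "m \<in> M" for m
    using C_conj [OF that, of \<one>] that by simp
  \<comment> \<open>The choice depends on the set \<open>C m\<close> only, so elements of one class
    get literally the same representative. The class of \<open>\<one>\<close> is \<open>Z\<close>;
    taking \<open>\<one>\<close> there makes \<open>X\<close> meet \<open>Z\<close> in
    \<open>S\<close> itself and not in a translate of it.\<close>
  define r where "r m = (if \<one> \<in> C m then \<one> else SOME a. a \<in> C m)" for m
  have r_cong: "r m' = r m" if "C m' = C m" for m m'
    using that by (simp add: r_def)
  have r_C: "r m \<in> C m" if "m \<in> M" for m
    using C_self [OF that] by (auto simp: r_def intro: someI)
  have r_M [simp]: "r m \<in> M" if "m \<in> M" for m
    using r_C [OF that] CM [OF that] by auto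
  define X where "X = {conjugate g (r m) \<otimes> s | g m s. g \<in> carrier G \<and> m \<in> M \<and> s \<in> S}"
  have XI: "conjugate g (r m) \<otimes> s \<in> X" if "g \<in> carrier G" "m \<in> M" "s \<in> S" for g m s
    using that unfolding X_def by blast
  have X_M: "X \<subseteq> M"
    using SZ ZM subgroup.m_closed [OF M] by (force simp: X_def conjM)
  have r_one: "r z = \<one>" if "z \<in> Z" for z
  proof -
    have "z \<in> C \<one>"
      using C_coset [OF subgroup.one_closed [OF M] that] that by simp
    then have "\<one> \<in> C z"
      using C_sym subgroup.one_closed [OF M] by blast
    then show ?thesis by (simp add: r_def)
  qed
  have normal_X: "normal_subset G X"
  proof (rule normal_subsetI)
    show "X \<subseteq> carrier G" using X_M Mcl by blast
    fix h x assume h: "h \<in> carrier G" and "x \<in> X"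
    then obtain g m s where x: "g \<in> carrier G" "m \<in> M" "s \<in> S" "x = conjugate g (r m) \<otimes> s"
      unfolding X_def by blast
    \<comment> \<open>The central factor \<open>s\<close> is fixed by conjugation, so only the
      conjugating element changes.\<close>
    have "conjugate h x = conjugate (g \<otimes> h) (r m) \<otimes> s"
      using h x SZ by (simp add: conj_multZ conjugate_conjugate subsetD)
    then show "conjugate h x \<in> X" using h x XI by simp
  qed
  have X_Z: "X \<inter> Z = S"
  proof (intro equalityI subsetI)
    fix s assume s: "s \<in> S"
    have "conjugate \<one> (r \<one>) \<otimes> s \<in> X"
      using s subgroup.one_closed [OF M] by (intro XI) auto
    then show "s \<in> X \<inter> Z"
      using s SZ subgroup.one_closed [OF Z] by (auto simp: r_one)
  next
    fix x assume x: "x \<in> X \<inter> Z"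
    then obtain g m s where xe: "g \<in> carrier G" "m \<in> M" "s \<in> S" "x = conjugate g (r m) \<otimes> s"
      unfolding X_def by blast
    \<comment> \<open>Dividing by \<open>s\<close> puts the conjugate of \<open>r m\<close> into
      \<open>Z\<close>, where conjugation is trivial. Hence \<open>r m\<close> itself lies in
      \<open>Z\<close>, and idempotence of \<open>r\<close> forces it to be
      \<open>\<one>\<close>.\<close>
    then have "conjugate g (r m) = x \<otimes> inv s"
      by (simp add: m_assoc)
    also have "\<dots> \<in> Z"
      using x xe SZ subgroup.m_closed [OF Z] subgroup.m_inv_closed [OF Z] by auto
    finally have cZ: "conjugate g (r m) \<in> Z" .
    then have "conjugate (inv g) (conjugate g (r m)) = conjugate g (r m)"
      using xe by (intro conjZ) auto
    then have rZ: "r m \<in> Z" using cZ xe by simp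
    have "C (r m) = C m"
      using C_eq [OF xe(2) r_C [OF xe(2)]] .
    then have "r (r m) = r m" by (rule r_cong)
    then have "r m = \<one>" using r_one [OF rZ] by simp
    then show "x \<in> S" using xe by simp
  qed
  have "\<exists>a \<in> m <# Z. X \<inter> (m <# Z) = a <# S" if m: "m \<in> M" for m
  proof -
    obtain g z where g: "g \<in> carrier G" "z \<in> Z" "m = conjugate g (r m) \<otimes> z"
      using C_sym [OF m r_C [OF m]] unfolding C_def by blast
    \<comment> \<open>The conjugate of the chosen representative that falls into the coset of
      \<open>m\<close>.\<close>
    define a where "a = conjugate g (r m)"
    have a: "a = m \<otimes> inv z" "a \<in> M"
      using g m by (simp_all add: a_def conjM) (metis Mcl conjugate_closed g(1) inv_solve_right r_M Zcl)
    have aZ: "a \<in> m <# Z"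
      using a g subgroup.m_inv_closed [OF Z] by (auto simp: l_coset_def)
    have "X \<inter> (m <# Z) = a <# S"
    proof (intro equalityI subsetI)
      fix x assume "x \<in> a <# S"
      then obtain s where s: "s \<in> S" "x = a \<otimes> s" by (auto simp: l_coset_def)
      have "x = m \<otimes> (inv z \<otimes> s)" using s a g m by (simp add: m_assoc)
      moreover have "inv z \<otimes> s \<in> Z"
        using s g SZ subgroup.m_closed [OF Z] subgroup.m_inv_closed [OF Z] by auto
      ultimately show "x \<in> X \<inter> (m <# Z)"
        using s XI [OF g(1) m s(1)] unfolding a_def [symmetric] l_coset_def by auto
    next
      fix x assume "x \<in> X \<inter> (m <# Z)"
      then obtain h m' s w where x: "h \<in> carrier G" "m' \<in> M" "s \<in> S" "w \<in> Z"
          "x = conjugate h (r m') \<otimes> s" "x = m \<otimes> w"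
        unfolding X_def l_coset_def by blast
      have sw: "w \<otimes> inv s \<in> Z" "z \<otimes> (w \<otimes> inv s) \<in> Z"
        using x g SZ subgroup.m_closed [OF Z] subgroup.m_inv_closed [OF Z] by auto
      have c: "conjugate h (r m') = m \<otimes> (w \<otimes> inv s)"
      proof -
        have "conjugate h (r m') = (conjugate h (r m') \<otimes> s) \<otimes> inv s"
          using x(1-4) by (simp add: m_assoc)
        also have "\<dots> = (m \<otimes> w) \<otimes> inv s"
          using x(5,6) by simp
        finally show ?thesis using x(3,4) m by (simp add: m_assoc)
      qed
      \<comment> \<open>The two sides of \<open>c\<close> have the classes of \<open>m'\<close> and
        of \<open>m\<close>, so \<open>x\<close> arises from the same representative as
        \<open>a\<close>.\<close>
      have "C (conjugate h (r m')) = C (r m')"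
        using C_eq C_conj r_M x(1,2) by blast
      moreover have "C (r m') = C m'"
        using C_eq r_C x(2) by blast
      moreover have "C (m \<otimes> (w \<otimes> inv s)) = C m"
        using C_eq C_coset m sw(1) by blast
      ultimately have "C m' = C m" unfolding c by metis
      then have req: "r m' = r m" by (rule r_cong)
      \<comment> \<open>The discrepancy between two conjugates of \<open>r m\<close> in one coset of
        \<open>Z\<close>. Undoing the conjugation by \<open>g\<close> leaves the central
        \<open>v\<close> fixed and exhibits it as the commutator of \<open>r m\<close> with
        \<open>h \<otimes> inv g\<close>, so \<open>stab\<close> applies.\<close>
      define v where "v = z \<otimes> (w \<otimes> inv s)"
      have vZ: "v \<in> Z" using sw by (simp add: v_def)
      have cv: "conjugate h (r m) = conjugate g (r m) \<otimes> v"
      proof -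
        have "conjugate h (r m) = (conjugate g (r m) \<otimes> z) \<otimes> (w \<otimes> inv s)"
          using c req g(3) by simp
        then show ?thesis using g(1,2) m x(3,4) by (simp add: v_def m_assoc)
      qed
      have "conjugate (h \<otimes> inv g) (r m) = conjugate (inv g) (conjugate g (r m) \<otimes> v)"
        using x(1) g(1) m by (simp add: conjugate_conjugate [symmetric] cv)
      also have "\<dots> = r m \<otimes> v"
        using g(1) m vZ by (simp add: conj_multZ)
      finally have "inv (r m) \<otimes> conjugate (h \<otimes> inv g) (r m) = v"
        using m vZ by (simp add: m_assoc [symmetric])
      then have "v <# S = S"
        using stab [of "h \<otimes> inv g" "r m"] x(1) g(1) m vZ by simp
      then have "v \<otimes> s \<in> S" using x(3) by (auto simp: l_coset_def)
      moreover have "x = a \<otimes> (v \<otimes> s)"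
        using x(3,5) g(1) m vZ by (simp add: a_def m_assoc req cv)
      ultimately show "x \<in> a <# S" by (auto simp: l_coset_def)
    qed
    then show ?thesis using aZ by blast
  qed
  with X_M normal_X X_Z show ?thesis by (rule that)
qed

section \<open>Central products\<close>

lemma central_product_sym:
  assumes "central_product G M N Z"
  shows "central_product G N M Z"
proof -
  have s: "subgroup M G" "subgroup N G" using assms by (auto simp: central_product_def)
  have c: "m \<otimes> n = n \<otimes> m" if "m \<in> M" "n \<in> N" for m n
    using assms that by (auto simp: central_product_def)
  have "M <#> N = N <#> M"
    unfolding set_mult_def using c by fastforce
  then show ?thesis using assms c by (auto simp: central_product_def)
qed

text \<open>For \<open>g = m' \<otimes> n\<close> the factor \<open>n\<close> centralizes
  \<open>M\<close>, so on \<open>M\<close> conjugation by \<open>g\<close> is conjugation by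
  \<open>m'\<close>. Commutators of \<open>M\<close> with \<open>G\<close> are thus already
  commutators of \<open>M\<close> with \<open>M\<close>, to which the kernel hypothesis
  applies.\<close>

lemma central_product_normal_extension:
  assumes cp: "central_product G M N Z" and SZ: "S \<subseteq> Z"
    and stab: "commutator_set G M M \<inter> Z \<subseteq> set_kernel (G\<lparr>carrier := Z\<rparr>) S"
  obtains X where "X \<subseteq> M" "normal_subset G X" "X \<inter> Z = S"
    "\<And>m. m \<in> M \<Longrightarrow> \<exists>a \<in> m <# Z. X \<inter> (m <# Z) = a <# S"
proof -
  have M: "subgroup M G" and N: "subgroup N G" and G: "carrier G = M <#> N"
    and comm: "\<And>m n. m \<in> M \<Longrightarrow> n \<in> N \<Longrightarrow> m \<otimes> n = n \<otimes> m" and Z: "Z = M \<inter> N"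
    using cp by (auto simp: central_product_def)
  note Mcl [simp] = subgroup.mem_carrier [OF M] and Ncl [simp] = subgroup.mem_carrier [OF N]
  have Zs: "subgroup Z G"
    unfolding Z by (rule subgroups_Inter_pair [OF M N])
  have conj: "\<exists>m' \<in> M. \<forall>m \<in> M. conjugate g m = conjugate m' m" if gG: "g \<in> carrier G" for g
  proof -
    obtain m' n where g: "m' \<in> M" "n \<in> N" "g = m' \<otimes> n"
      using gG unfolding G set_mult_def by blast
    have "conjugate g m = conjugate m' m" if "m \<in> M" for m
    proof -
      have "conjugate m' m \<in> M"
        using g that subgroup.m_closed [OF M] subgroup.m_inv_closed [OF M]
        by (simp add: conjugate_def)
      then have "conjugate n (conjugate m' m) = conjugate m' m"
        using g comm by (intro conjugate_commute) auto
      then show ?thesis using g that by (simp add: conjugate_conjugate)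
    qed
    then show ?thesis using g by blast
  qed
  show ?thesis
  proof (rule normal_extension_of_central_subset [OF M Zs _ _ _ SZ])
    show "Z \<subseteq> M" using Z by simp
    show "conjugate g m \<in> M" if gm: "g \<in> carrier G" "m \<in> M" for g m
    proof -
      obtain m' where "m' \<in> M" "conjugate g m = conjugate m' m"
        using conj [OF gm(1)] gm(2) by auto
      then show ?thesis
        using that subgroup.m_closed [OF M] subgroup.m_inv_closed [OF M]
        by (simp add: conjugate_def)
    qed
    \<comment> \<open>As an element of \<open>N\<close>, \<open>z\<close> commutes with
      \<open>M\<close>; as an element of \<open>M\<close>, it commutes with
      \<open>N\<close>.\<close>
    show "g \<otimes> z = z \<otimes> g" if gG: "g \<in> carrier G" and z: "z \<in> Z" for g z
    proof -
      obtain m n where g: "m \<in> M" "n \<in> N" "g = m \<otimes> n"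
        using gG unfolding G set_mult_def by blast
      have mnz: "m \<otimes> z = z \<otimes> m" "n \<otimes> z = z \<otimes> n"
        using z Z g comm [of m z] comm [of z n] by simp_all
      have "m \<otimes> (z \<otimes> n) = (m \<otimes> z) \<otimes> n" using z Z g by (simp add: m_assoc)
      then show ?thesis using z Z g mnz by (simp add: m_assoc)
    qed
    show "(inv m \<otimes> conjugate g m) <# S = S"
      if gm: "g \<in> carrier G" "m \<in> M" "inv m \<otimes> conjugate g m \<in> Z" for g m
    proof -
      obtain m' where m': "m' \<in> M" "conjugate g m = conjugate m' m"
        using conj [OF gm(1)] gm(2) by auto
      then have "inv m \<otimes> conjugate g m = inv m \<otimes> inv m' \<otimes> m \<otimes> m'"
        using that by (simp add: conjugate_def m_assoc)
      then have "inv m \<otimes> conjugate g m \<in> commutator_set G M M"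
        unfolding commutator_set_def using m' that by blast
      then have "inv m \<otimes> conjugate g m \<in> set_kernel (G\<lparr>carrier := Z\<rparr>) S"
        using stab that by blast
      then show ?thesis by (simp add: set_kernel_def l_coset_def)
    qed
  qed (use that in blast)
qed

end

section \<open>Assembling the factorization of \<open>G\<close>\<close>

theorem theorem1p9:
  fixes G :: "('a, 'b) monoid_scheme" and M N Z X0 Y0 :: "'a set"
  assumes "group G"
    and "central_product G M N Z"
    and "set_direct_factorization (G\<lparr>carrier := Z\<rparr>) X0 Y0"
    and "commutator_set G M M \<inter> Z \<subseteq> set_kernel (G\<lparr>carrier := Z\<rparr>) X0"
    and "commutator_set G N N \<inter> Z \<subseteq> set_kernel (G\<lparr>carrier := Z\<rparr>) Y0"
  shows "\<exists>X Y. set_direct_factorization G X Y \<and> X \<subseteq> M \<and> Y \<subseteq> N \<and> X \<inter> Z = X0 \<and> Y \<inter> Z = Y0"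
proof -
  interpret group G by fact
  have M: "subgroup M G" and N: "subgroup N G" and G: "carrier G = M <#>\<^bsub>G\<^esub> N"
    and comm: "\<And>m n. m \<in> M \<Longrightarrow> n \<in> N \<Longrightarrow> m \<otimes>\<^bsub>G\<^esub> n = n \<otimes>\<^bsub>G\<^esub> m" and Z: "Z = M \<inter> N"
    using assms(2) by (auto simp: central_product_def)
  note Mcl [simp] = subgroup.mem_carrier [OF M] and Ncl [simp] = subgroup.mem_carrier [OF N]
  have Zs: "subgroup Z G"
    unfolding Z by (rule subgroups_Inter_pair [OF M N])
  note Zcl [simp] = subgroup.mem_carrier [OF Zs]
  \<comment> \<open>Restricting the carrier leaves the multiplication unchanged, so the setwise
    product formed in \<open>Z\<close> is the one formed in \<open>G\<close>.\<close>
  have direct: "set_direct (G\<lparr>carrier := Z\<rparr>) X0 Y0" and Z_eq: "Z = X0 <#>\<^bsub>G\<^esub> Y0"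
    using assms(3) unfolding set_direct_factorization_def set_mult_def by auto
  have XY0: "X0 \<subseteq> Z" "Y0 \<subseteq> Z" "X0 \<noteq> {}" "Y0 \<noteq> {}"
    using direct by (simp_all add: set_direct_def normal_subset_def)
  have uniq: "\<forall>g \<in> X0 <#>\<^bsub>G\<^esub> Y0. \<exists>!p. p \<in> X0 \<times> Y0 \<and> g = fst p \<otimes>\<^bsub>G\<^esub> snd p"
    using direct by (simp add: set_direct_def set_mult_def)
  have uniq': "u = u' \<and> v = v'"
    if "u \<in> X0" "u' \<in> X0" "v \<in> Y0" "v' \<in> Y0" "u \<otimes>\<^bsub>G\<^esub> v = u' \<otimes>\<^bsub>G\<^esub> v'" for u u' v v'
  proof -
    have "u \<otimes>\<^bsub>G\<^esub> v \<in> X0 <#>\<^bsub>G\<^esub> Y0"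
      using that by (auto simp: set_mult_def)
    with uniq have "\<exists>!p. p \<in> X0 \<times> Y0 \<and> u \<otimes>\<^bsub>G\<^esub> v = fst p \<otimes>\<^bsub>G\<^esub> snd p"
      by blast
    then have "(u, v) = (u', v')"
      by (rule ex1E) (metis that SigmaI fst_conv snd_conv)
    then show ?thesis by simp
  qed
  obtain X where X: "X \<subseteq> M" "normal_subset G X" "X \<inter> Z = X0"
    "\<And>m. m \<in> M \<Longrightarrow> \<exists>a \<in> m <#\<^bsub>G\<^esub> Z. X \<inter> (m <#\<^bsub>G\<^esub> Z) = a <#\<^bsub>G\<^esub> X0"
    using central_product_normal_extension [OF assms(2) XY0(1) assms(4)] by blast
  obtain Y where Y: "Y \<subseteq> N" "normal_subset G Y" "Y \<inter> Z = Y0"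
    "\<And>n. n \<in> N \<Longrightarrow> \<exists>b \<in> n <#\<^bsub>G\<^esub> Z. Y \<inter> (n <#\<^bsub>G\<^esub> Z) = b <#\<^bsub>G\<^esub> Y0"
    using central_product_normal_extension [OF central_product_sym [OF assms(2)] XY0(2) assms(5)]
    by blast
  have cosetM: "a \<in> M" if "a \<in> m <#\<^bsub>G\<^esub> Z" "m \<in> M" for a m
    using that Z subgroup.m_closed [OF M] by (auto simp: l_coset_def)
  have cosetN: "b \<in> N" if "b \<in> n <#\<^bsub>G\<^esub> Z" "n \<in> N" for b n
    using that Z subgroup.m_closed [OF N] by (auto simp: l_coset_def)
  have self_coset: "m \<in> m <#\<^bsub>G\<^esub> Z" if "m \<in> carrier G" for m
    using that subgroup.one_closed [OF Zs] by (force simp: l_coset_def)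
  have swap: "a \<otimes>\<^bsub>G\<^esub> u \<otimes>\<^bsub>G\<^esub> (b \<otimes>\<^bsub>G\<^esub> v) = a \<otimes>\<^bsub>G\<^esub> b \<otimes>\<^bsub>G\<^esub> (u \<otimes>\<^bsub>G\<^esub> v)"
    if "a \<in> M" "b \<in> N" "u \<in> Z" "v \<in> Z" for a b u v
    using that Z by (intro central_factor_swap) (auto simp: comm)
  have cover: "g \<in> X <#>\<^bsub>G\<^esub> Y" if gG: "g \<in> carrier G" for g
  proof -
    obtain m n where g: "m \<in> M" "n \<in> N" "g = m \<otimes>\<^bsub>G\<^esub> n"
      using gG unfolding G set_mult_def by blast
    obtain a where a: "a \<in> m <#\<^bsub>G\<^esub> Z" "X \<inter> (m <#\<^bsub>G\<^esub> Z) = a <#\<^bsub>G\<^esub> X0"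
      using X(4) g by blast
    obtain b where b: "b \<in> n <#\<^bsub>G\<^esub> Z" "Y \<inter> (n <#\<^bsub>G\<^esub> Z) = b <#\<^bsub>G\<^esub> Y0"
      using Y(4) g by blast
    have aM: "a \<in> M" and bN: "b \<in> N" using a b g cosetM cosetN by auto
    \<comment> \<open>Membership in a coset is symmetric, so \<open>m\<close> and \<open>n\<close>
      can be expressed through \<open>a\<close> and \<open>b\<close>. The central remainder
      \<open>z \<otimes> w\<close> is then factored in \<open>Z\<close> and its parts are
      redistributed to \<open>a\<close> and \<open>b\<close>.\<close>
    have "m \<in> a <#\<^bsub>G\<^esub> Z" "n \<in> b <#\<^bsub>G\<^esub> Z"
      using a b g self_coset l_repr_independence [OF _ _ Zs] by auto
    then obtain z w where zw: "z \<in> Z" "w \<in> Z" "m = a \<otimes>\<^bsub>G\<^esub> z" "n = b \<otimes>\<^bsub>G\<^esub> w"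
      by (auto simp: l_coset_def)
    have "z \<otimes>\<^bsub>G\<^esub> w \<in> X0 <#>\<^bsub>G\<^esub> Y0"
      using zw subgroup.m_closed [OF Zs] Z_eq by blast
    then obtain u v where uv: "u \<in> X0" "v \<in> Y0" "z \<otimes>\<^bsub>G\<^esub> w = u \<otimes>\<^bsub>G\<^esub> v"
      by (auto simp: set_mult_def)
    have "g = a \<otimes>\<^bsub>G\<^esub> b \<otimes>\<^bsub>G\<^esub> (z \<otimes>\<^bsub>G\<^esub> w)"
      using g zw aM bN swap by simp
    also have "\<dots> = (a \<otimes>\<^bsub>G\<^esub> u) \<otimes>\<^bsub>G\<^esub> (b \<otimes>\<^bsub>G\<^esub> v)"
      using uv XY0 aM bN swap by (simp add: subsetD)
    finally have "g = (a \<otimes>\<^bsub>G\<^esub> u) \<otimes>\<^bsub>G\<^esub> (b \<otimes>\<^bsub>G\<^esub> v)" .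
    moreover have "a \<otimes>\<^bsub>G\<^esub> u \<in> X" using a uv by (auto simp: l_coset_def)
    moreover have "b \<otimes>\<^bsub>G\<^esub> v \<in> Y" using b uv by (auto simp: l_coset_def)
    ultimately show ?thesis by (auto simp: set_mult_def)
  qed
  have inj: "x = x' \<and> y = y'"
    if xy: "x \<in> X" "x' \<in> X" "y \<in> Y" "y' \<in> Y" "x \<otimes>\<^bsub>G\<^esub> y = x' \<otimes>\<^bsub>G\<^esub> y'" for x x' y y'
  proof -
    have xM: "x \<in> M" "x' \<in> M" "y \<in> N" "y' \<in> N" using xy X Y by auto
    \<comment> \<open>From \<open>x y = x' y'\<close> this element also equals \<open>y\<close>
      times the inverse of \<open>y'\<close>, so it lies in both \<open>M\<close> and
      \<open>N\<close>. Hence \<open>x\<close>, \<open>x'\<close> share a coset of \<open>Z\<close>,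
      and so do \<open>y\<close>, \<open>y'\<close>.\<close>
    define z where "z = inv\<^bsub>G\<^esub> x \<otimes>\<^bsub>G\<^esub> x'"
    have "z \<otimes>\<^bsub>G\<^esub> y' = y"
      using xM xy(5) unfolding z_def by (metis Mcl Ncl inv_closed inv_solve_left m_assoc m_closed)
    then have z: "z = y \<otimes>\<^bsub>G\<^esub> inv\<^bsub>G\<^esub> y'"
      using xM unfolding z_def by (metis Mcl Ncl inv_closed inv_solve_right m_closed)
    have zZ: "z \<in> Z"
      using Z xM subgroup.m_closed [OF M] subgroup.m_inv_closed [OF M]
        subgroup.m_closed [OF N] subgroup.m_inv_closed [OF N]
      by (metis IntI z z_def)
    have x': "x' = x \<otimes>\<^bsub>G\<^esub> z"
      using xM by (simp add: z_def m_assoc [symmetric])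
    have "y = z \<otimes>\<^bsub>G\<^esub> y'"
      using xM by (simp add: z m_assoc)
    then have y: "y = y' \<otimes>\<^bsub>G\<^esub> z"
      using comm [of z y'] zZ Z xM by simp
    obtain a where a: "a \<in> x <#\<^bsub>G\<^esub> Z" "X \<inter> (x <#\<^bsub>G\<^esub> Z) = a <#\<^bsub>G\<^esub> X0"
      using X(4) xM by blast
    obtain b where b: "b \<in> y' <#\<^bsub>G\<^esub> Z" "Y \<inter> (y' <#\<^bsub>G\<^esub> Z) = b <#\<^bsub>G\<^esub> Y0"
      using Y(4) xM by blast
    have aM: "a \<in> M" and bN: "b \<in> N" using a b xM cosetM cosetN by auto
    \<comment> \<open>Both elements lie in \<open>X\<close> and in the coset of \<open>x\<close>, so
      one translate of \<open>X0\<close> contains both. The same argument with the coset of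
      \<open>y'\<close> handles \<open>y\<close> and \<open>y'\<close>.\<close>
    have "x \<in> a <#\<^bsub>G\<^esub> X0" "x' \<in> a <#\<^bsub>G\<^esub> X0"
      using xy xM self_coset x' zZ unfolding a(2) [symmetric] by (auto simp: l_coset_def)
    then obtain u u' where u: "u \<in> X0" "u' \<in> X0" "x = a \<otimes>\<^bsub>G\<^esub> u" "x' = a \<otimes>\<^bsub>G\<^esub> u'"
      by (auto simp: l_coset_def)
    have "y \<in> b <#\<^bsub>G\<^esub> Y0" "y' \<in> b <#\<^bsub>G\<^esub> Y0"
      using xy xM self_coset y zZ unfolding b(2) [symmetric] by (auto simp: l_coset_def)
    then obtain v v' where v: "v \<in> Y0" "v' \<in> Y0" "y = b \<otimes>\<^bsub>G\<^esub> v" "y' = b \<otimes>\<^bsub>G\<^esub> v'"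
      by (auto simp: l_coset_def)
    have Zuv: "u \<in> Z" "u' \<in> Z" "v \<in> Z" "v' \<in> Z" using u v XY0 by auto
    \<comment> \<open>Once the central parts are collected, the common factor \<open>a b\<close>
      cancels and the uniqueness in \<open>X0 Y0\<close> decides.\<close>
    then have "a \<otimes>\<^bsub>G\<^esub> b \<otimes>\<^bsub>G\<^esub> (u \<otimes>\<^bsub>G\<^esub> v) = a \<otimes>\<^bsub>G\<^esub> b \<otimes>\<^bsub>G\<^esub> (u' \<otimes>\<^bsub>G\<^esub> v')"
      using xy(5) u v aM bN swap by simp
    then have "u \<otimes>\<^bsub>G\<^esub> v = u' \<otimes>\<^bsub>G\<^esub> v'"
      using aM bN Zuv by simp
    then show ?thesis using uniq' u v by blast
  qed
  have "set_direct_factorization G X Y"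
    unfolding set_direct_factorization_def set_direct_def
  proof (intro conjI ballI)
    show "X \<noteq> {}" "Y \<noteq> {}" using X(3) Y(3) XY0 by auto
    show "carrier G = X <#>\<^bsub>G\<^esub> Y"
    proof
      show "carrier G \<subseteq> X <#>\<^bsub>G\<^esub> Y" using cover by blast
      show "X <#>\<^bsub>G\<^esub> Y \<subseteq> carrier G"
        unfolding G using X(1) Y(1) by (rule mono_set_mult)
    qed
    fix g assume "g \<in> X <#>\<^bsub>G\<^esub> Y"
    then obtain x y where g: "x \<in> X" "y \<in> Y" "g = x \<otimes>\<^bsub>G\<^esub> y"
      by (auto simp: set_mult_def)
    show "\<exists>!p. p \<in> X \<times> Y \<and> g = fst p \<otimes>\<^bsub>G\<^esub> snd p"
    proof (rule ex1I [of _ "(x, y)"])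
      show "(x, y) \<in> X \<times> Y \<and> g = fst (x, y) \<otimes>\<^bsub>G\<^esub> snd (x, y)" using g by simp
    qed (use g inj in force)
  qed (use X(2) Y(2) in auto)
  then show ?thesis using X Y by blast
qed

end
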